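(* Let $n \equiv 2 \pmod 4$ be a positive integer. Write $n^2 + 16 = y^2 d$ with $y$ a positive integer and $d$ squarefree, and assume that $$\epsilon = \frac{n + y\sqrt{d}}{4}$$ is the fundamental unit of $k_n = \mathbb{Q}(\sqrt{d})$. Define $u_j = \frac{\epsilon^j - \overline{\epsilon}^j}{\epsilon - \overline{\epsilon}}$ and $v_j = \epsilon^j + \overline{\epsilon}^j$ for $j \geq 0$, where $\overline{\epsilon}$ is the Galois conjugate of $\epsilon$. Let $r_0$ be the smallest odd positive index $r$ for which $d \mid u_r$, and suppose there is a prime $p \equiv 1 \pmod 4$ dividing $v_{r_0}$ such that $d\,u_{r_0}$ is a quadratic nonresidue modulo $p$. Then there is no positive integer $m \neq n$ with $K_m = K_n$.
   Context: For a positive integer $n \neq 3$, $K_n = \mathbb{Q}(\rho)$ where $\rho$ is a root of $f_n(x) = x^4 - n x^3 - 6x^2 + n x + 1$ (a cyclic quartic field, with unique quadratic subfield $k_n = \mathbb{Q}(\sqrt{n^2+16})$); for $m = 3$ one does not define $K_m$, so $m$ ranges over positive integers $\neq 3$. With $t = \mathrm{Trace}(\epsilon)$, the numbers $u_j, v_j$ are integers satisfying $u_0 = 0$, $u_1 = 1$, $u_{j+2} = t u_{j+1} + u_j$ and $v_0 = 2$, $v_1 = t$, $v_{j+2} = t v_{j+1} + v_j$. *)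

theory Defs
  imports
    Complex_Main
    "HOL-Algebra.Generated_Fields"
    "HOL-Algebra.Algebraic_Closure_Type"
    "HOL-Computational_Algebra.Computational_Algebra"
    "HOL-Number_Theory.Number_Theory"
begin

text \<open>The prime field of a field of characteristic 0 is contained in every generated subfield, so
  \<open>rat_adjoin x\<close> is \<open>\<rat>(x)\<close>.\<close>

definition rat_adjoin :: "'a::field_char_0 \<Rightarrow> 'a set" where
  "rat_adjoin x = generate_field ring_of_type_algebra {x}"

definition quartic_poly :: "nat \<Rightarrow> 'a::comm_ring_1 poly" where
  "quartic_poly n = [:1, of_nat n, -6, - of_nat n, 1:]"

text \<open>For \<open>n > 0\<close>, \<open>n \<noteq> 3\<close> the extension is normal, so every root of \<open>quartic_poly n\<close> generates the same
  subfield of the complex numbers, and exactly one \<open>K\<close> satisfies the predicate. It is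
  formulated for an arbitrary root rather than for a chosen one.\<close>

definition is_quartic_field :: "nat \<Rightarrow> complex set \<Rightarrow> bool" where
  "is_quartic_field n K \<longleftrightarrow> (\<exists>\<rho>. poly (quartic_poly n) \<rho> = 0 \<and> K = rat_adjoin \<rho>)"

definition ring_of_integers :: "'a::field_char_0 set \<Rightarrow> 'a set" where
  "ring_of_integers F = {x \<in> F. algebraic_int x}"

definition integer_units :: "'a::field_char_0 set \<Rightarrow> 'a set" where
  "integer_units F = {x \<in> ring_of_integers F. \<exists>y \<in> ring_of_integers F. x * y = 1}"

text \<open>For a real quadratic field: the generator, modulo \<open>\<plusminus>1\<close>, of the unit group that exceeds 1.\<close>

definition fundamental_unit :: "real set \<Rightarrow> real \<Rightarrow> bool" where
  "fundamental_unit F \<epsilon> \<longleftrightarrow> \<epsilon> \<in> integer_units F \<and> \<epsilon> > 1 \<and>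
     (\<forall>\<eta> \<in> integer_units F. \<exists>k::int. \<eta> = \<epsilon> powi k \<or> \<eta> = - (\<epsilon> powi k))"

end

theory Submission
  imports Defs
begin

text \<open>
  If \<open>\<rho>\<close> is a root of \<open>quartic_poly n\<close>, then \<open>z = \<rho> - 1/\<rho>\<close> satisfies \<open>z\<^sup>2 - n z - 4 = 0\<close>, so \<open>z\<close> is
  twice \<open>\<epsilon>\<close> or its conjugate, and \<open>s = \<rho> + 1/\<rho>\<close> satisfies \<open>s\<^sup>2 = z\<^sup>2 + 4 = z y \<surd>d\<close>. Thus \<open>K\<^sub>n\<close> is the
  quadratic extension \<open>k(s)\<close> of \<open>k = \<rat>(\<surd>d)\<close>. By Kummer theory, \<open>K\<^sub>m = K\<^sub>n\<close> forces \<open>m\<^sup>2 + 16 = Y\<^sup>2 d\<close> and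
  \<open>(m + Y \<surd>d) Y\<close> and \<open>(n + y \<surd>d) y\<close> to differ by a square of \<open>k\<close>. Since \<open>d \<equiv> 5 (mod 8)\<close>, \<open>m\<close> is
  even and \<open>(m + Y \<surd>d)/4\<close> is a unit of norm \<open>-1\<close>, hence equals \<open>\<epsilon> ^ j\<close> with \<open>j\<close> odd; so \<open>m = 2 v\<^sub>j\<close>,
  \<open>Y = y u\<^sub>j\<close>, and \<open>u\<^sub>j\<close> is a square in \<open>k\<close>, that is, \<open>u\<^sub>j = a\<^sup>2\<close> or \<open>u\<^sub>j = d a\<^sup>2\<close>. In the first case
  Cohn's argument gives \<open>j = 1\<close> and \<open>m = n\<close>. In the second case \<open>r\<^sub>0\<close> divides \<open>j\<close>, so
  \<open>u\<^sub>j \<equiv> u\<^bsub>r\<^sub>0\<^esub> (mod v\<^bsub>r\<^sub>0\<^esub>)\<close>, and \<open>d u\<^bsub>r\<^sub>0\<^esub>\<close> is a square modulo \<open>p\<close>.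
\<close>

section \<open>Subfields and quadratic extensions\<close>

text \<open>As \<open>inverse 0 = 0\<close>, closure under \<open>inverse\<close> covers 0 as well;
  that 0 belongs to the set follows from 1 + (-1).\<close>

definition is_subfield :: "'a::field_char_0 set \<Rightarrow> bool" where
  "is_subfield S \<longleftrightarrow> 1 \<in> S \<and> (\<forall>x\<in>S. - x \<in> S \<and> inverse x \<in> S) \<and>
     (\<forall>x\<in>S. \<forall>y\<in>S. x + y \<in> S \<and> x * y \<in> S)"

lemma is_subfieldD:
  assumes "is_subfield S"
  shows "1 \<in> S" "x \<in> S \<Longrightarrow> - x \<in> S" "x \<in> S \<Longrightarrow> inverse x \<in> S"
    "x \<in> S \<Longrightarrow> y \<in> S \<Longrightarrow> x + y \<in> S" "x \<in> S \<Longrightarrow> y \<in> S \<Longrightarrow> x * y \<in> S"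
    "x \<in> S \<Longrightarrow> y \<in> S \<Longrightarrow> x - y \<in> S" "x \<in> S \<Longrightarrow> y \<in> S \<Longrightarrow> x / y \<in> S"
    "0 \<in> S" "x \<in> S \<Longrightarrow> x ^ k \<in> S"
proof -
  show *: "1 \<in> S" "x \<in> S \<Longrightarrow> - x \<in> S" "x \<in> S \<Longrightarrow> inverse x \<in> S"
    "x \<in> S \<Longrightarrow> y \<in> S \<Longrightarrow> x + y \<in> S" "x \<in> S \<Longrightarrow> y \<in> S \<Longrightarrow> x * y \<in> S" for x y
    using assms by (auto simp: is_subfield_def)
  show "x \<in> S \<Longrightarrow> y \<in> S \<Longrightarrow> x - y \<in> S" using *(2,4) by (metis diff_conv_add_uminus)
  show "x \<in> S \<Longrightarrow> y \<in> S \<Longrightarrow> x / y \<in> S" using *(3,5) by (metis divide_inverse)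
  show "0 \<in> S" using *(1,2,4) by (metis add.right_inverse)
  show "x \<in> S \<Longrightarrow> x ^ k \<in> S" by (induction k) (auto intro: *)
qed

lemma Rats_subset_subfield:
  assumes "is_subfield S"
  shows "\<rat> \<subseteq> S"
proof
  fix x :: 'a assume "x \<in> \<rat>"
  have nat: "of_nat k \<in> S" for k
    by (induction k) (auto intro: is_subfieldD[OF assms])
  have int: "of_int k \<in> S" for k
    by (cases k rule: int_cases2) (auto intro: is_subfieldD[OF assms] nat)
  from \<open>x \<in> \<rat>\<close> show "x \<in> S"
    by (cases x rule: Rats_cases') (auto intro: is_subfieldD[OF assms] int)
qed

lemma is_subfield_Rats: "is_subfield \<rat>"
  by (auto simp: is_subfield_def)

section \<open>The field generated by one element\<close>

lemma ring_of_type_algebra_m_inv: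
  fixes x :: "'a::field"
  assumes "x \<noteq> 0"
  shows "inv\<^bsub>ring_of_type_algebra\<^esub> x = inverse x"
proof -
  interpret R: field "ring_of_type_algebra :: 'a ring" by (rule field_from_type_algebra)
  show ?thesis
    by (rule R.inv_char) (use assms in \<open>auto simp: ring_of_type_algebra_def\<close>)
qed

lemma ring_of_type_algebra_a_inv:
  fixes x :: "'a::field"
  shows "\<ominus>\<^bsub>ring_of_type_algebra\<^esub> x = - x"
proof -
  interpret R: field "ring_of_type_algebra :: 'a ring" by (rule field_from_type_algebra)
  show ?thesis
    by (rule R.minus_equality) (auto simp: ring_of_type_algebra_def)
qed

lemma self_in_rat_adjoin: "x \<in> rat_adjoin x"
  by (simp add: rat_adjoin_def generate_field.incl)

lemma is_subfield_rat_adjoin: "is_subfield (rat_adjoin x)"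
proof -
  note [simp] = ring_of_type_algebra_def
  have zero: "0 \<in> rat_adjoin x"
    using generate_field.eng_add[OF generate_field.one generate_field.a_inv[OF generate_field.one],
        of "ring_of_type_algebra :: 'a ring" "{x}"]
    unfolding rat_adjoin_def ring_of_type_algebra_a_inv by simp
  have inv: "inverse a \<in> rat_adjoin x" if "a \<in> rat_adjoin x" for a
  proof (cases "a = 0")
    case False
    then show ?thesis
      using that generate_field.m_inv[of a "ring_of_type_algebra :: 'a ring" "{x}"]
      unfolding rat_adjoin_def ring_of_type_algebra_m_inv[OF False] by simp
  qed (use zero in simp)
  have neg: "- a \<in> rat_adjoin x" if "a \<in> rat_adjoin x" for a
    using that generate_field.a_inv[of a "ring_of_type_algebra :: 'a ring" "{x}"]
    unfolding rat_adjoin_def ring_of_type_algebra_a_inv by simp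
  show ?thesis
    unfolding is_subfield_def
    using inv neg generate_field.one[of "ring_of_type_algebra :: 'a ring" "{x}"]
      generate_field.eng_add[of _ "ring_of_type_algebra :: 'a ring" "{x}"]
      generate_field.eng_mult[of _ "ring_of_type_algebra :: 'a ring" "{x}"]
    by (simp add: rat_adjoin_def)
qed

lemma rat_adjoin_subset:
  assumes "is_subfield S" "x \<in> S"
  shows "rat_adjoin x \<subseteq> S"
proof
  fix h assume "h \<in> rat_adjoin x"
  then have "h \<in> generate_field ring_of_type_algebra {x}" by (simp add: rat_adjoin_def)
  then show "h \<in> S"
  proof induction
    case (m_inv h)
    then have "h \<noteq> 0" by (simp add: ring_of_type_algebra_def)
    then show ?case using m_inv by (simp add: ring_of_type_algebra_m_inv is_subfieldD[OF assms(1)])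
  next
    case (a_inv h)
    then show ?case by (simp add: ring_of_type_algebra_a_inv is_subfieldD[OF assms(1)])
  qed (use assms in \<open>auto simp: ring_of_type_algebra_def intro!: is_subfieldD[OF assms(1)]\<close>)
qed

text \<open>The \<open>S\<close>-span of 1 and \<open>s\<close>, which is the field
  \<open>S(s)\<close> if \<open>s\<^sup>2\<close> lies in \<open>S\<close> and \<open>s\<close> does
  not.\<close>

definition quad_ext :: "'a::field_char_0 set \<Rightarrow> 'a \<Rightarrow> 'a set" where
  "quad_ext S s = {a + b * s | a b. a \<in> S \<and> b \<in> S}"

lemma quad_extI: "a \<in> S \<Longrightarrow> b \<in> S \<Longrightarrow> a + b * s \<in> quad_ext S s"
  by (auto simp: quad_ext_def)

lemma quad_ext_base_subset:
  assumes "is_subfield S"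
  shows "S \<subseteq> quad_ext S s"
  using quad_extI[of _ S 0 s] is_subfieldD(8)[OF assms] by auto

lemma quad_ext_gen:
  assumes "is_subfield S"
  shows "s \<in> quad_ext S s"
  using quad_extI[of 0 S 1 s] is_subfieldD(1,8)[OF assms] by auto

lemma quad_ext_coeff_eq:
  assumes S: "is_subfield S" and s: "s \<notin> S"
    and "a \<in> S" "b \<in> S" "a' \<in> S" "b' \<in> S" and eq: "a + b * s = a' + b' * s"
  shows "a = a' \<and> b = b'"
proof (rule ccontr)
  assume "\<not> ?thesis"
  then have ne: "b \<noteq> b'" using eq by auto
  have "(b - b') * s = a' - a" using eq by (simp add: algebra_simps)
  then have "s = (a' - a) / (b - b')" using ne by (simp add: field_simps)
  also have "\<dots> \<in> S" by (intro is_subfieldD[OF S] assms)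
  finally show False using s by contradiction
qed

lemma is_subfield_quad_ext:
  assumes S: "is_subfield S" and sq: "s\<^sup>2 \<in> S" and s: "s \<notin> S"
  shows "is_subfield (quad_ext S s)"
proof -
  note S' = is_subfieldD[OF S]
  have mult: "x * y \<in> quad_ext S s" if x: "x \<in> quad_ext S s" and y: "y \<in> quad_ext S s" for x y
  proof -
    obtain a b a' b' where ab: "x = a + b * s" "y = a' + b' * s" "a \<in> S" "b \<in> S" "a' \<in> S" "b' \<in> S"
      using x y by (auto simp: quad_ext_def)
    have "x * y = (a * a' + b * b' * s\<^sup>2) + (a * b' + a' * b) * s"
      by (simp add: ab power2_eq_square algebra_simps)
    also have "\<dots> \<in> quad_ext S s" by (intro quad_extI S' ab sq)
    finally show ?thesis .
  qed
  have inv: "inverse x \<in> quad_ext S s" if x: "x \<in> quad_ext S s" for x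
  proof -
    obtain a b where ab: "x = a + b * s" "a \<in> S" "b \<in> S"
      using x by (auto simp: quad_ext_def)
    define N where "N = a\<^sup>2 - b\<^sup>2 * s\<^sup>2"
    have N: "N = (a + b * s) * (a - b * s)"
      by (simp add: N_def power2_eq_square algebra_simps)
    show ?thesis
    proof (cases "x = 0")
      case True
      then show ?thesis using quad_ext_base_subset[OF S] S'(8) by auto
    next
      case False
      have "a - b * s \<noteq> 0"
      proof
        assume "a - b * s = 0"
        then have "a + (- b) * s = 0 + 0 * s" by simp
        then have "a = 0 \<and> b = 0"
          using quad_ext_coeff_eq[OF S s, of a "- b" 0 0] ab S'(2,8) by simp
        then show False using False ab by simp
      qed
      then have "inverse x = (a - b * s) / N"
        using False N ab by (simp add: inverse_eq_divide)
      then have "inverse x = a / N + (- b / N) * s"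
        by (simp add: diff_divide_distrib)
      moreover have "N \<in> S" using ab sq by (auto simp: N_def intro!: S')
      ultimately show ?thesis using ab by (simp only:) (intro quad_extI S')
    qed
  qed
  have neg: "- x \<in> quad_ext S s" if "x \<in> quad_ext S s" for x
    using mult[OF _ that, of "-1"] quad_ext_base_subset[OF S] S'(2)[OF S'(1)] by auto
  have add: "x + y \<in> quad_ext S s" if x: "x \<in> quad_ext S s" and y: "y \<in> quad_ext S s" for x y
  proof -
    obtain a b a' b' where ab: "x = a + b * s" "y = a' + b' * s" "a \<in> S" "b \<in> S" "a' \<in> S" "b' \<in> S"
      using x y by (auto simp: quad_ext_def)
    have "x + y = (a + a') + (b + b') * s" by (simp add: ab algebra_simps)
    also have "\<dots> \<in> quad_ext S s" by (intro quad_extI S' ab)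
    finally show ?thesis .
  qed
  show ?thesis
    unfolding is_subfield_def
    by (intro conjI ballI mult inv neg add subsetD[OF quad_ext_base_subset[OF S] S'(1)])
qed

text \<open>The core of Kummer theory for exponent 2: in the square of \<open>a + b * s\<close> the
  cross term \<open>2 * a * b\<close> must vanish.\<close>

lemma quad_ext_square_in_base:
  assumes S: "is_subfield S" and sq: "s\<^sup>2 \<in> S" and s: "s \<notin> S"
    and x: "x \<in> quad_ext S s" "x\<^sup>2 \<in> S"
  shows "x \<in> S \<or> (\<exists>b\<in>S. x = b * s)"
proof -
  note S' = is_subfieldD[OF S]
  obtain a b where ab: "x = a + b * s" "a \<in> S" "b \<in> S"
    using x by (auto simp: quad_ext_def)
  have "(a\<^sup>2 + b\<^sup>2 * s\<^sup>2) + (2 * a * b) * s = x\<^sup>2 + 0 * s"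
    by (simp add: ab power2_eq_square algebra_simps)
  moreover have "2 \<in> S" using S'(4)[OF S'(1) S'(1)] by simp
  ultimately have "2 * a * b = 0"
    using quad_ext_coeff_eq[OF S s, of "a\<^sup>2 + b\<^sup>2 * s\<^sup>2" "2 * a * b" "x\<^sup>2" 0] ab x sq
    by (simp add: S')
  then show ?thesis using ab by auto
qed

lemma rat_adjoin_sqrt:
  assumes "s\<^sup>2 \<in> \<rat>" "s \<notin> \<rat>"
  shows "rat_adjoin s = quad_ext \<rat> s"
proof
  show "rat_adjoin s \<subseteq> quad_ext \<rat> s"
    by (intro rat_adjoin_subset is_subfield_quad_ext is_subfield_Rats quad_ext_gen assms)
  show "quad_ext \<rat> s \<subseteq> rat_adjoin s"
    using Rats_subset_subfield[OF is_subfield_rat_adjoin[of s]] self_in_rat_adjoin[of s]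
    by (auto simp: quad_ext_def intro!: is_subfieldD(4,5)[OF is_subfield_rat_adjoin])
qed

section \<open>Rational numbers with integral squares\<close>

lemma Rats_square_in_Ints:
  fixes x :: "'a::field_char_0"
  assumes "x \<in> \<rat>" "x\<^sup>2 \<in> \<int>"
  shows "x \<in> \<int>"
proof -
  have "algebraic_int x"
    by (rule algebraic_int_root[of "x\<^sup>2" "monom 1 2"])
      (use assms in \<open>auto simp: poly_monom degree_monom_eq intro: int_imp_algebraic_int\<close>)
  then show ?thesis using assms rational_algebraic_int_is_int by blast
qed

text \<open>Divide by \<open>g = gcd d e\<close>: the cofactor \<open>d'\<close> of \<open>d\<close>
  is coprime to that of \<open>e\<close>, hence divides \<open>g\<close>, so that
  \<open>d'\<^sup>2\<close> divides \<open>d\<close>.\<close>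

lemma squarefree_dvd_square_imp_dvd:
  fixes d e :: nat
  assumes "squarefree d" "d dvd e\<^sup>2"
  shows "d dvd e"
proof -
  define g where "g = gcd d e"
  have "d \<noteq> 0" using assms(1) by (metis not_squarefree_0)
  then obtain d' e' where de: "d = g * d'" "e = g * e'" "coprime d' e'"
    using gcd_coprime_exists[of d e] unfolding g_def by (auto simp: mult.commute)
  have "g \<noteq> 0" using \<open>d \<noteq> 0\<close> de by auto
  then have "d' dvd g * e'\<^sup>2"
    using assms(2) de by (auto simp: power2_eq_square mult_ac)
  then have "d' dvd g" using de(3) by (simp add: coprime_dvd_mult_left_iff)
  then have "d'\<^sup>2 dvd d" by (auto simp: de power2_eq_square)
  then have "d' dvd 1" using assms(1) squarefreeD by blast
  then show ?thesis unfolding de by (intro mult_dvd_mono) (auto intro: dvd_trans[of _ 1])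
qed

text \<open>\<open>x * d\<close> has square \<open>N * d\<close>, so it is an integer;
  \<open>d\<close> divides its square and therefore the integer itself.\<close>

lemma Rats_squarefree_times_square_in_Ints:
  fixes x :: "'a::field_char_0" and d :: nat
  assumes "squarefree d" "x \<in> \<rat>" "x\<^sup>2 * of_nat d = of_int N"
  shows "\<exists>k::int. x = of_int k \<and> k\<^sup>2 * int d = N"
proof -
  have "(x * of_nat d)\<^sup>2 = of_int (N * int d)"
    by (simp add: power_mult_distrib assms(3)[symmetric] power2_eq_square mult.assoc)
  moreover have "x * of_nat d \<in> \<rat>" using assms(2) by simp
  ultimately have "x * of_nat d \<in> \<int>"
    using Rats_square_in_Ints Ints_of_int by metis
  then obtain e where e: "x * of_nat d = of_int e" by (auto elim: Ints_cases)
  have "of_int (e\<^sup>2) = (of_int (N * int d) :: 'a)"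
    using \<open>(x * of_nat d)\<^sup>2 = _\<close> e by simp
  then have "e\<^sup>2 = N * int d" by (simp only: of_int_eq_iff)
  then have "int d dvd (int (nat \<bar>e\<bar>))\<^sup>2" by simp
  then have "d dvd (nat \<bar>e\<bar>)\<^sup>2" by (simp only: of_nat_dvd_iff flip: of_nat_power)
  then have "d dvd nat \<bar>e\<bar>" using assms(1) by (rule squarefree_dvd_square_imp_dvd[rotated])
  then have "int d dvd e" by simp
  then obtain k where "e = int d * k" by blast
  moreover have "d \<noteq> 0" using assms(1) by (metis not_squarefree_0)
  ultimately have x: "x = of_int k" using e by auto
  then have "of_int (k\<^sup>2 * int d) = (of_int N :: 'a)" using assms(3) by simp
  then show ?thesis using x by (auto simp only: of_int_eq_iff)
qed

lemma Rats_square_neq_squarefree: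
  fixes x :: "'a::field_char_0"
  assumes "squarefree d" "d \<noteq> 1" "x \<in> \<rat>"
  shows "x\<^sup>2 \<noteq> of_nat d"
proof
  assume eq: "x\<^sup>2 = of_nat d"
  then have "x \<in> \<int>" using assms(3) Rats_square_in_Ints[of x] by simp
  then obtain e where "x = of_int e" by (auto elim: Ints_cases)
  then have "of_int (e\<^sup>2) = (of_int (int d) :: 'a)" using eq by simp
  then have e: "e\<^sup>2 = int d" by (simp only: of_int_eq_iff)
  then have "(nat \<bar>e\<bar>)\<^sup>2 = d" by (metis nat_int nat_power_eq power2_abs abs_ge_zero)
  then have "nat \<bar>e\<bar> dvd 1" using assms(1) squarefreeD[of d "nat \<bar>e\<bar>"] by simp
  then show False using \<open>(nat \<bar>e\<bar>)\<^sup>2 = d\<close> assms(2) by simp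
qed

section \<open>The quartic fields\<close>

text \<open>Norms of rational multiples of squares are squares. Used in the contrapositive, to show
  that an element of nonsquare norm is no such multiple.\<close>

lemma quad_ext_Rats_norm_square:
  assumes w: "w\<^sup>2 = of_nat d" "w \<notin> \<rat>" and "p \<in> \<rat>" "q \<in> \<rat>" "M \<in> \<rat>" "x \<in> quad_ext \<rat> w"
    and eq: "p + q * w = M * x\<^sup>2"
  shows "\<exists>r\<in>\<rat>. p\<^sup>2 - q\<^sup>2 * of_nat d = r\<^sup>2"
proof -
  obtain e f where ef: "e \<in> \<rat>" "f \<in> \<rat>" "x = e + f * w"
    using assms by (auto simp: quad_ext_def)
  have "x\<^sup>2 = e\<^sup>2 + f\<^sup>2 * w\<^sup>2 + 2 * e * f * w"
    by (simp add: ef power2_eq_square algebra_simps)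
  then have "p + q * w = M * (e\<^sup>2 + f\<^sup>2 * of_nat d) + (2 * M * e * f) * w"
    by (simp add: eq w algebra_simps)
  then have "p = M * (e\<^sup>2 + f\<^sup>2 * of_nat d) \<and> q = 2 * M * e * f"
    by (rule quad_ext_coeff_eq[OF is_subfield_Rats w(2), rotated 4]) (use assms ef in auto)
  then have "p\<^sup>2 - q\<^sup>2 * of_nat d = (M * (e\<^sup>2 - f\<^sup>2 * of_nat d))\<^sup>2"
    by (simp add: power2_eq_square algebra_simps)
  moreover have "M * (e\<^sup>2 - f\<^sup>2 * of_nat d) \<in> \<rat>" using assms ef by auto
  ultimately show ?thesis by blast
qed

text \<open>Division by \<open>\<rho>\<^sup>2\<close> turns the quartic into
  \<open>z\<^sup>2 - n * z - 4\<close>; completing the square gives the first equation.\<close>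

lemma quartic_poly_root:
  fixes \<rho> :: "'a::field_char_0"
  assumes "poly (quartic_poly n) \<rho> = 0"
  defines "z \<equiv> \<rho> - inverse \<rho>" and "s \<equiv> \<rho> + inverse \<rho>"
  shows "(2 * z - of_nat n)\<^sup>2 = of_nat (n\<^sup>2 + 16)" "s\<^sup>2 = z\<^sup>2 + 4" "2 * \<rho> = z + s"
proof -
  have root: "\<rho> ^ 4 - of_nat n * \<rho> ^ 3 - 6 * \<rho>\<^sup>2 + of_nat n * \<rho> + 1 = 0"
    using assms(1) by (simp add: quartic_poly_def numeral_eq_Suc algebra_simps)
  then have nz: "\<rho> \<noteq> 0" by auto
  have "\<rho>\<^sup>2 * (z\<^sup>2 - of_nat n * z - 4) = \<rho> ^ 4 - of_nat n * \<rho> ^ 3 - 6 * \<rho>\<^sup>2 + of_nat n * \<rho> + 1"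
    using nz by (simp add: z_def field_simps) (simp add: numeral_eq_Suc algebra_simps)
  then have "z\<^sup>2 - of_nat n * z - 4 = 0" using root nz by simp
  then have z2: "z\<^sup>2 = of_nat n * z + 4" by (simp add: algebra_simps)
  have "(2 * z - of_nat n)\<^sup>2 = 4 * z\<^sup>2 - 4 * of_nat n * z + (of_nat n)\<^sup>2"
    by (simp add: power2_eq_square algebra_simps)
  then show "(2 * z - of_nat n)\<^sup>2 = of_nat (n\<^sup>2 + 16)"
    by (simp add: z2 algebra_simps)
  show "s\<^sup>2 = z\<^sup>2 + 4"
    using nz by (simp add: s_def z_def power2_eq_square algebra_simps)
  show "2 * \<rho> = z + s" by (simp add: s_def z_def)
qed

text \<open>The reason for excluding 3: the root \<open>e\<close> lies strictly between
  \<open>m\<close> and \<open>m + 4\<close>, and parity rules out \<open>m + 1\<close> and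
  \<open>m + 3\<close>.\<close>

lemma square_plus_16_square:
  fixes m e :: nat
  assumes "m > 0" "e\<^sup>2 = m\<^sup>2 + 16"
  shows "m = 3"
proof -
  have "e > m"
    using assms(2) power_mono[of e m 2] by (cases "e \<le> m") auto
  moreover have "e < m + 4"
  proof (rule ccontr)
    assume "\<not> ?thesis"
    then have "(m + 4)\<^sup>2 \<le> e\<^sup>2" by (intro power_mono) auto
    then show False using assms by (simp add: power2_eq_square algebra_simps)
  qed
  ultimately have "e = m + 1 \<or> e = m + 2 \<or> e = m + 3" by arith
  then show ?thesis
  proof (elim disjE)
    assume "e = m + 1"
    then have "2 * m + 1 = 16" using assms(2) by (simp add: power2_eq_square algebra_simps)
    then show ?thesis by presburger
  next
    assume "e = m + 2"
    then have "4 * m + 4 = 16" using assms(2) by (simp add: power2_eq_square algebra_simps)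
    then show ?thesis by simp
  next
    assume "e = m + 3"
    then have "6 * m + 9 = 16" using assms(2) by (simp add: power2_eq_square algebra_simps)
    then show ?thesis by presburger
  qed
qed

text \<open>The right-hand side is \<open>(w / 2) * y * (a + y * w)\<close>; in a quotient of two
  such elements \<open>w / 2\<close> cancels, leaving the square class of
  \<open>(a + y * w) * y\<close>.\<close>

lemma discriminant_element_eq:
  fixes w z :: "'a::field_char_0"
  assumes "w\<^sup>2 = D" and "a\<^sup>2 + 16 = y\<^sup>2 * D" and "2 * z = a + y * w"
  shows "z\<^sup>2 + 4 = y\<^sup>2 * D / 2 + (a * y / 2) * w"
proof -
  have "4 * (z\<^sup>2 + 4) = (2 * z)\<^sup>2 + 16" by (simp add: power2_eq_square)
  also have "\<dots> = (a\<^sup>2 + 16) + y\<^sup>2 * w\<^sup>2 + 2 * a * y * w"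
    unfolding assms(3) by (simp add: power2_eq_square algebra_simps)
  also have "\<dots> = 4 * (y\<^sup>2 * D / 2 + (a * y / 2) * w)"
    by (simp add: assms(1,2))
  finally show ?thesis by (simp only: mult_cancel_left) simp
qed

text \<open>The two equations compare the coefficients of 1 and \<open>sqrt d\<close> in
  \<open>(m + Y * sqrt d) * Y = (e + f * sqrt d)\<^sup>2 * (n + y * sqrt d) * y\<close>. They are stated over the rationals because
  the square root of \<open>d\<close> attached to \<open>\<rho>\<close> may be the negative one, while the unit argument needs the
  positive one.\<close>

lemma quartic_root_in_quartic_field:
  fixes \<rho> \<sigma> :: complex and n m y d :: nat
  assumes \<rho>: "poly (quartic_poly n) \<rho> = 0" and \<sigma>: "poly (quartic_poly m) \<sigma> = 0"
    and mem: "\<sigma> \<in> rat_adjoin \<rho>"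
    and n: "n\<^sup>2 + 16 = y\<^sup>2 * d" and "y > 0" and d: "squarefree d" "d \<noteq> 1"
    and m: "m > 0" "m \<noteq> 3"
  shows "\<exists>(Y::int) (e::rat) (f::rat). Y \<noteq> 0 \<and> Y\<^sup>2 * int d = int (m\<^sup>2 + 16) \<and>
    of_nat m * of_int Y = (e\<^sup>2 + f\<^sup>2 * of_nat d) * of_nat n * of_nat y +
      2 * e * f * (of_nat y)\<^sup>2 * of_nat d \<and>
    (of_int Y)\<^sup>2 = (e\<^sup>2 + f\<^sup>2 * of_nat d) * (of_nat y)\<^sup>2 + 2 * e * f * of_nat n * of_nat y"
proof -
  define z s where "z = \<rho> - inverse \<rho>" and "s = \<rho> + inverse \<rho>"
  define z' s' where "z' = \<sigma> - inverse \<sigma>" and "s' = \<sigma> + inverse \<sigma>"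
  note zs = quartic_poly_root[OF \<rho>, folded z_def s_def]
  note zs' = quartic_poly_root[OF \<sigma>, folded z'_def s'_def]
  define w where "w = (2 * z - of_nat n) / of_nat y"
  have d0: "d > 0" using d(1) by (metis not_squarefree_0 not_gr_zero)
  have nC: "(of_nat n)\<^sup>2 + 16 = (of_nat y)\<^sup>2 * (of_nat d :: complex)"
    using arg_cong[OF n, of "of_nat :: nat \<Rightarrow> complex"] by simp
  have w2: "w\<^sup>2 = of_nat d"
    using zs(1) \<open>y > 0\<close> nC by (simp add: w_def power_divide)
  have w: "w \<notin> \<rat>" using Rats_square_neq_squarefree[OF d] w2 by blast
  have z: "2 * z = of_nat n + of_nat y * w" using \<open>y > 0\<close> by (simp add: w_def)
  define k where "k = quad_ext \<rat> w"
  have k: "is_subfield k"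
    unfolding k_def by (rule is_subfield_quad_ext[OF is_subfield_Rats]) (use w w2 in auto)
  note k' = is_subfieldD[OF k]
  have Qk: "\<rat> \<subseteq> k" by (rule Rats_subset_subfield[OF k])
  have wk: "w \<in> k" unfolding k_def by (rule quad_ext_gen[OF is_subfield_Rats])
  have half: "x \<in> k" if "2 * x \<in> k" for x
  proof -
    have "x = 2 * x / 2" by simp
    also have "\<dots> \<in> k" by (rule k'(7)[OF that]) (use Qk in auto)
    finally show ?thesis .
  qed
  \<comment> \<open>The norm from \<open>k\<close> to the rationals of the left-hand side below is \<open>4 * Y\<^sup>2 * d\<close>.\<close>
  have nonsquare: False
    if "Y \<noteq> 0" "(of_nat a)\<^sup>2 + 16 = (of_int Y)\<^sup>2 * (of_nat d :: complex)" "M \<in> \<rat>" "x \<in> k"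
      "(of_int Y)\<^sup>2 * of_nat d / 2 + (of_nat a * of_int Y / 2) * w = M * x\<^sup>2" for a :: nat and Y :: int and M x
  proof -
    have "\<exists>r\<in>\<rat>. ((of_int Y)\<^sup>2 * of_nat d / 2)\<^sup>2 - (of_nat a * of_int Y / 2 :: complex)\<^sup>2 * of_nat d = r\<^sup>2"
      by (rule quad_ext_Rats_norm_square[OF w2 w _ _ that(3) _ that(5)]) (use that in \<open>auto simp: k_def\<close>)
    then obtain r :: complex where r: "r \<in> \<rat>"
      "((of_int Y)\<^sup>2 * of_nat d / 2)\<^sup>2 - (of_nat a * of_int Y / 2)\<^sup>2 * of_nat d = r\<^sup>2"
      by blast
    have a2: "(of_nat a)\<^sup>2 = (of_int Y)\<^sup>2 * of_nat d - (16 :: complex)"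
      using that(2) by (simp add: algebra_simps)
    have "((of_int Y)\<^sup>2 * of_nat d / 2)\<^sup>2 - (of_nat a * of_int Y / 2)\<^sup>2 * of_nat d
      = 4 * (of_int Y)\<^sup>2 * (of_nat d :: complex)"
      by (simp add: power_mult_distrib power_divide a2) (simp add: power2_eq_square power4_eq_xxxx field_simps)
    then have "r\<^sup>2 = 4 * (of_int Y)\<^sup>2 * of_nat d" using r(2) by simp
    then have "(r / (2 * of_int Y))\<^sup>2 = of_nat d"
      using \<open>Y \<noteq> 0\<close> by (simp add: power_divide power_mult_distrib)
    moreover have "r / (2 * of_int Y) \<in> \<rat>" using r by auto
    ultimately show False using Rats_square_neq_squarefree[OF d] by blast
  qed
  have s2: "s\<^sup>2 = (of_int (int y))\<^sup>2 * of_nat d / 2 + (of_nat n * of_int (int y) / 2) * w"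
    using discriminant_element_eq[OF w2 nC z] zs(2) by simp
  have s2k: "s\<^sup>2 \<in> k"
    unfolding s2 using Qk by (intro k'(4,5) wk) auto
  have nonsquare_s: False if "M \<in> \<rat>" "x \<in> k" "s\<^sup>2 = M * x\<^sup>2" for M x
    by (rule nonsquare[of "int y" n M x]) (use that \<open>y > 0\<close> nC s2 in auto)
  \<comment> \<open>The case \<open>M = 1\<close>: so \<open>L\<close> is quadratic over
    \<open>k\<close>. It contains \<open>\<rho>\<close>, hence \<open>\<sigma>\<close>.\<close>
  have sk: "s \<notin> k" using nonsquare_s[of 1 s] by auto
  define L where "L = quad_ext k s"
  have L: "is_subfield L"
    unfolding L_def by (rule is_subfield_quad_ext[OF k s2k sk])
  note L' = is_subfieldD[OF L]
  have kL: "k \<subseteq> L" unfolding L_def by (rule quad_ext_base_subset[OF k])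
  have QL: "\<rat> \<subseteq> L" by (rule Rats_subset_subfield[OF L])
  have sL: "s \<in> L" unfolding L_def by (rule quad_ext_gen[OF k])
  have "z \<in> k" by (rule half, unfold z) (use Qk in \<open>intro k'(4,5) wk; auto\<close>)
  have "\<rho> = (z + s) / 2" using zs(3) by (simp add: mult.commute)
  also have "\<dots> \<in> L"
    using \<open>z \<in> k\<close> kL QL sL by (intro L'(7,4)) auto
  finally have "\<sigma> \<in> L" using rat_adjoin_subset[OF L] mem by blast
  then have zL: "z' \<in> L" "s' \<in> L" unfolding z'_def s'_def by (auto intro: L')
  \<comment> \<open>\<open>\<delta>\<close> is a square root of \<open>m\<^sup>2 + 16\<close> in
    \<open>L\<close>. Descending from \<open>L\<close> to \<open>k\<close> and from \<open>k\<close>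
    to the rationals leaves only \<open>\<delta> = b * w\<close>: the case \<open>b * s\<close>
    would make \<open>s\<^sup>2\<close> a rational times a square, and a rational
    \<open>\<delta>\<close> would force \<open>m = 3\<close>.\<close>
  define \<delta> where "\<delta> = 2 * z' - of_nat m"
  have \<delta>2: "\<delta>\<^sup>2 = of_nat (m\<^sup>2 + 16)" using zs'(1) by (simp add: \<delta>_def)
  have "\<delta> \<in> L" unfolding \<delta>_def using zL QL by (intro L'(6,5)) auto
  moreover have "\<delta>\<^sup>2 \<in> k" using \<delta>2 Qk by auto
  ultimately have "\<delta> \<in> k \<or> (\<exists>b\<in>k. \<delta> = b * s)"
    unfolding L_def by (intro quad_ext_square_in_base[OF k s2k sk])
  moreover have False if b: "b \<in> k" "\<delta> = b * s" for b
  proof -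
    have "b\<^sup>2 * s\<^sup>2 = of_nat (m\<^sup>2 + 16)" using \<delta>2 b by (simp add: power_mult_distrib)
    moreover have "b \<noteq> 0"
    proof
      assume "b = 0"
      then have "of_nat (m\<^sup>2 + 16) = (0::complex)" using \<delta>2 b by simp
      then show False by (simp only: of_nat_eq_0_iff)
    qed
    ultimately have "s\<^sup>2 = of_nat (m\<^sup>2 + 16) * (inverse b)\<^sup>2"
      by (simp add: field_simps)
    then show False using nonsquare_s[of "of_nat (m\<^sup>2 + 16)" "inverse b"] k'(3) b by auto
  qed
  ultimately have "\<delta> \<in> k" by blast
  then have "\<delta> \<in> \<rat> \<or> (\<exists>b\<in>\<rat>. \<delta> = b * w)"
    unfolding k_def using w w2 \<delta>2 by (intro quad_ext_square_in_base[OF is_subfield_Rats]) auto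
  moreover have False if "\<delta> \<in> \<rat>"
  proof -
    have "\<delta> \<in> \<int>" using Rats_square_in_Ints[OF that] \<delta>2 by auto
    then obtain e where "\<delta> = of_int e" by (auto elim: Ints_cases)
    then have "of_int (e\<^sup>2) = (of_int (int (m\<^sup>2 + 16)) :: complex)" using \<delta>2 by simp
    then have "e\<^sup>2 = int (m\<^sup>2 + 16)" by (simp only: of_int_eq_iff)
    then have "int ((nat \<bar>e\<bar>)\<^sup>2) = int (m\<^sup>2 + 16)" by simp
    then have "(nat \<bar>e\<bar>)\<^sup>2 = m\<^sup>2 + 16" by (simp only: of_nat_eq_iff)
    then show False using square_plus_16_square m by blast
  qed
  ultimately obtain b where b: "b \<in> \<rat>" "\<delta> = b * w" by blast
  then have "b\<^sup>2 * of_nat d = of_int (int (m\<^sup>2 + 16))"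
    using \<delta>2 w2 by (simp add: power_mult_distrib)
  then obtain Y where Y: "b = of_int Y" "Y\<^sup>2 * int d = int (m\<^sup>2 + 16)"
    using Rats_squarefree_times_square_in_Ints[OF d(1) b(1)] by blast
  have Y0: "Y \<noteq> 0"
  proof
    assume "Y = 0"
    then have "int (m\<^sup>2 + 16) = 0" using Y(2) by simp
    then show False by (simp only: of_nat_eq_0_iff)
  qed
  have z': "2 * z' = of_nat m + of_int Y * w" using b Y by (simp add: \<delta>_def algebra_simps)
  have mC: "(of_nat m)\<^sup>2 + 16 = (of_int Y)\<^sup>2 * (of_nat d :: complex)"
    using arg_cong[OF Y(2), of "of_int :: int \<Rightarrow> complex"] by simp
  have s'2: "s'\<^sup>2 = (of_int Y)\<^sup>2 * of_nat d / 2 + (of_nat m * of_int Y / 2) * w"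
    using discriminant_element_eq[OF w2 mC z'] zs'(2) by simp
  have "s'\<^sup>2 \<in> k" unfolding s'2 using Qk by (intro k'(4,5) wk) auto
  then have "s' \<in> k \<or> (\<exists>b\<in>k. s' = b * s)"
    using zL unfolding L_def by (intro quad_ext_square_in_base[OF k s2k sk])
  \<comment> \<open>The norm excludes \<open>s'\<close> from \<open>k\<close>, so \<open>s'\<close>
    and \<open>s\<close> differ by a factor in \<open>k\<close>.\<close>
  moreover have "s' \<notin> k" using nonsquare[OF Y0 mC, of 1 s'] s'2 by auto
  ultimately obtain c where c: "c \<in> k" "s' = c * s" by blast
  then obtain e f where ef: "c = of_rat e + of_rat f * w"
    by (auto simp: k_def quad_ext_def elim!: Rats_cases)
  have c2: "c\<^sup>2 = (of_rat e)\<^sup>2 + (of_rat f)\<^sup>2 * of_nat d + 2 * of_rat e * of_rat f * w"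
    by (simp add: ef w2[symmetric] power2_eq_square algebra_simps)
  let ?P = "(e\<^sup>2 + f\<^sup>2 * of_nat d) * (of_nat y)\<^sup>2 + 2 * e * f * of_nat n * of_nat y"
  let ?Q = "(e\<^sup>2 + f\<^sup>2 * of_nat d) * of_nat n * of_nat y + 2 * e * f * (of_nat y)\<^sup>2 * of_nat d"
  \<comment> \<open>Expand \<open>s'\<^sup>2 = c\<^sup>2 * s\<^sup>2\<close> in the basis 1,
    \<open>w\<close>; both coefficients of 1 carry the factor \<open>d / 2\<close>, which is
    cancelled at the end.\<close>
  have "(of_rat ((of_int Y)\<^sup>2 * of_nat d / 2) + of_rat (of_nat m * of_int Y / 2) * w) = c\<^sup>2 * s\<^sup>2"
    using c s'2 by (simp add: of_rat_mult of_rat_divide of_rat_power power_mult_distrib)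
  also have "\<dots> = ((of_rat e)\<^sup>2 + (of_rat f)\<^sup>2 * of_nat d) * (of_nat y)\<^sup>2 * of_nat d / 2
      + of_rat e * of_rat f * of_nat n * of_nat y * w\<^sup>2
      + (((of_rat e)\<^sup>2 + (of_rat f)\<^sup>2 * of_nat d) * of_nat n * of_nat y / 2
      + of_rat e * of_rat f * (of_nat y)\<^sup>2 * of_nat d) * w"
    unfolding c2 s2 by (simp add: field_simps power2_eq_square)
  also have "\<dots> = of_rat (?P * of_nat d / 2) + of_rat (?Q / 2) * w"
    unfolding w2 by (simp add: of_rat_mult of_rat_divide of_rat_power of_rat_add field_simps)
  finally have "of_rat ((of_int Y)\<^sup>2 * of_nat d / 2) = (of_rat (?P * of_nat d / 2) :: complex) \<and>
      of_rat (of_nat m * of_int Y / 2) = (of_rat (?Q / 2) :: complex)"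
    by (rule quad_ext_coeff_eq[OF is_subfield_Rats w, rotated 4]) auto
  then have "(of_int Y)\<^sup>2 = ?P" "of_nat m * of_int Y = ?Q"
    unfolding of_rat_eq_iff using d0 by auto
  then show ?thesis using Y0 Y(2) by blast
qed

section \<open>Lucas sequences\<close>

text \<open>The Lucas sequences of \<open>X\<^sup>2 - t * X - 1\<close>, given by recurrence over
  the integers so that congruences follow by induction; Binet's formulas later identify them with
  \<open>u\<close> and \<open>v\<close>.\<close>

fun lucas_u :: "int \<Rightarrow> nat \<Rightarrow> int" where
  "lucas_u t 0 = 0"
| "lucas_u t (Suc 0) = 1"
| "lucas_u t (Suc (Suc j)) = t * lucas_u t (Suc j) + lucas_u t j"

fun lucas_v :: "int \<Rightarrow> nat \<Rightarrow> int" where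
  "lucas_v t 0 = 2"
| "lucas_v t (Suc 0) = t"
| "lucas_v t (Suc (Suc j)) = t * lucas_v t (Suc j) + lucas_v t j"

lemma lucas_u_add:
  "lucas_u t (Suc (a + b)) = lucas_u t (Suc a) * lucas_u t (Suc b) + lucas_u t a * lucas_u t b"
proof (induction t a rule: lucas_u.induct)
  case (3 t a)
  have "lucas_u t (Suc (Suc (Suc a) + b)) = t * lucas_u t (Suc (Suc a + b)) + lucas_u t (Suc (a + b))"
    by simp
  then show ?case by (simp only: 3 lucas_u.simps) (simp add: algebra_simps)
qed auto

text \<open>For the roots \<open>\<alpha>\<close>, \<open>\<beta>\<close> of the characteristic
  polynomial, multiply out \<open>(\<alpha> ^ (a + b) - \<beta> ^ (a + b)) * (\<alpha> ^ b + \<beta>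
  ^ b)\<close>; the sign comes from \<open>\<alpha> * \<beta> = -1\<close>.\<close>

lemma lucas_u_add_double:
  "lucas_u t (a + 2 * b) + (-1) ^ b * lucas_u t a = lucas_u t (a + b) * lucas_v t b"
proof (induction b arbitrary: a rule: induct_nat_012)
  case (ge2 b)
  \<comment> \<open>The indices are regrouped so that the induction hypotheses apply at
    \<open>Suc a\<close> and at \<open>Suc (Suc a)\<close>.\<close>
  have "lucas_u t (a + Suc (Suc b)) * lucas_v t (Suc (Suc b)) =
      t * (lucas_u t (Suc a + Suc b) * lucas_v t (Suc b)) +
      lucas_u t (Suc (Suc a) + b) * lucas_v t b"
    by (simp add: algebra_simps)
  also have "\<dots> = t * (lucas_u t (Suc a + 2 * Suc b) + (-1) ^ Suc b * lucas_u t (Suc a)) +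
      (lucas_u t (Suc (Suc a) + 2 * b) + (-1) ^ b * lucas_u t (Suc (Suc a)))"
    by (simp only: ge2.IH)
  also have "\<dots> = lucas_u t (a + 2 * Suc (Suc b)) + (-1) ^ Suc (Suc b) * lucas_u t a"
    by (simp add: algebra_simps)
  finally show ?case by simp
qed (simp_all add: algebra_simps)

lemma lucas_v_eq: "lucas_v t (Suc j) = lucas_u t (Suc (Suc j)) + lucas_u t j"
proof (induction t j rule: lucas_u.induct)
  case (3 t j)
  have "lucas_v t (Suc (Suc (Suc j))) = t * lucas_v t (Suc (Suc j)) + lucas_v t (Suc j)"
    by simp
  then show ?case by (simp only: 3 lucas_u.simps) (simp add: algebra_simps)
qed auto

lemma lucas_u_cassini: "lucas_u t j * lucas_u t (Suc (Suc j)) = (lucas_u t (Suc j))\<^sup>2 - (-1) ^ j"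
proof (induction j)
  case (Suc j)
  then show ?case by (simp add: algebra_simps power2_eq_square)
qed simp

text \<open>Combines the doubling case of \<open>lucas_u_add\<close> with Cassini's identity. It
  evaluates the term just below index \<open>2 * Suc j\<close> modulo
  \<open>lucas_v t (Suc j)\<close>.\<close>

lemma lucas_u_double_pred:
  "lucas_u t (2 * j + 1) = lucas_u t j * lucas_v t (Suc j) + (-1) ^ j"
  using lucas_u_add[of t j j] lucas_u_cassini[of t j]
  by (simp add: lucas_v_eq algebra_simps power2_eq_square mult_2[symmetric])

lemma coprime_lucas_u_Suc: "coprime (lucas_u t j) (lucas_u t (Suc j))"
proof (induction j)
  case (Suc j)
  then have "gcd (lucas_u t (Suc j)) (t * lucas_u t (Suc j) + lucas_u t j) = 1"
    by (simp only: gcd_add_mult coprime_iff_gcd_eq_1 gcd.commute)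
  then show ?case by (simp add: coprime_iff_gcd_eq_1)
qed simp

section \<open>Squares among the terms of odd index\<close>

lemma lucas_v_pos: "t > 0 \<Longrightarrow> lucas_v t j > 0"
  by (induction t j rule: lucas_v.induct) (auto intro: add_pos_pos)

text \<open>For odd \<open>t\<close> the number \<open>t\<^sup>2 + 3\<close> is a multiple of 4 and
  divides \<open>lucas_v t (i + 6) - lucas_v t i\<close>, so there is a period 6 modulo 4 and only
  the indices 2 and 4 remain.\<close>

lemma lucas_v_mod_4:
  assumes "odd t" "even j" "\<not> 3 dvd j"
  shows "lucas_v t j mod 4 = 3"
proof -
  have step: "[lucas_v t (i + 6) = lucas_v t i] (mod 4)" for i
  proof -
    obtain m where m: "t = 2 * m + 1" using \<open>odd t\<close> by (elim oddE)
    have "4 dvd t\<^sup>2 + 3"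
      unfolding m by (intro dvdI[of _ _ "m\<^sup>2 + m + 1"]) (simp add: algebra_simps power2_eq_square)
    moreover have "lucas_v t (i + 6) - lucas_v t i =
        (t\<^sup>2 + 3) * ((t\<^sup>2 + 1) * t * lucas_v t (Suc i) + t\<^sup>2 * lucas_v t i)"
      by (simp add: numeral_eq_Suc algebra_simps)
    ultimately show ?thesis by (simp add: cong_iff_dvd_diff)
  qed
  have red: "[lucas_v t (6 * i + s) = lucas_v t s] (mod 4)" for i s
  proof (induction i)
    case (Suc i)
    then show ?case using step[of "6 * i + s"] by (auto simp: algebra_simps intro: cong_trans)
  qed simp
  have "lucas_v t 2 mod 4 = 3" "lucas_v t 4 mod 4 = 3"
  proof -
    obtain m where m: "t = 2 * m + 1" using \<open>odd t\<close> by (elim oddE)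
    have "lucas_v t 2 = 4 * (m\<^sup>2 + m) + 3"
      by (simp add: m numeral_eq_Suc algebra_simps)
    then show "lucas_v t 2 mod 4 = 3" by presburger
    have "lucas_v t 4 = 4 * (4 * m ^ 4 + 8 * m ^ 3 + 10 * m\<^sup>2 + 6 * m + 1) + 3"
      by (simp add: m numeral_eq_Suc algebra_simps)
    then show "lucas_v t 4 mod 4 = 3" by presburger
  qed
  moreover have "j mod 6 = 2 \<or> j mod 6 = 4" using assms by presburger
  ultimately show ?thesis using red[of "j div 6" "j mod 6"] by (auto simp: cong_def)
qed

text \<open>By Euler's criterion -1 is a nonresidue modulo a prime congruent to 3 modulo 4. The
  induction removes one prime factor at a time, each being 1 modulo 4.\<close>

lemma no_square_minus_one_mod_4:
  fixes N :: nat and a :: int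
  assumes "int N dvd a\<^sup>2 + 1"
  shows "N mod 4 \<noteq> 3"
  using assms
proof (induction N rule: less_induct)
  case (less N)
  show ?case
  proof (cases "N \<le> 1 \<or> even N")
    case True
    then show ?thesis by (cases "even N") (auto, presburger)
  next
    case False
    then obtain q where q: "prime q" "q dvd N" by (metis One_nat_def linorder_not_le nat_neq_iff prime_factor_nat)
    then obtain M where M: "N = q * M" by blast
    have "odd q" using False q by (metis dvd_trans)
    have "int q dvd a\<^sup>2 + 1" "int M dvd a\<^sup>2 + 1"
      using less.prems M by (metis dvd_trans dvd_triv_left dvd_triv_right of_nat_mult)+
    have "M > 0" using False M by (auto intro: Nat.gr0I)
    then have "M < N" using M prime_gt_1_nat[OF q(1)] by simp
    then have "M mod 4 \<noteq> 3" using less.IH \<open>int M dvd a\<^sup>2 + 1\<close> by blast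
    have "q mod 4 \<noteq> 3"
    proof
      assume "q mod 4 = 3"
      then have "q > 2" by (cases "q = 2") (use prime_ge_2_nat[OF q(1)] in auto)
      have "odd ((q - 1) div 2)" using \<open>q mod 4 = 3\<close> by presburger
      have "QuadRes (int q) (-1)"
        using \<open>int q dvd a\<^sup>2 + 1\<close> by (auto simp: QuadRes_def cong_iff_dvd_diff)
      moreover have "\<not> [-1 = 0] (mod int q)"
        using q(1) by (auto simp: cong_iff_dvd_diff)
      ultimately have "[1 = (-1) ^ ((q - 1) div 2)] (mod int q)"
        using euler_criterion[OF q(1) \<open>q > 2\<close>, of "-1"] by (simp add: Legendre_def)
      then have "int q dvd 2" using \<open>odd ((q - 1) div 2)\<close> by (simp add: cong_iff_dvd_diff)
      then show False using \<open>q > 2\<close> by (auto dest: zdvd_imp_le)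
    qed
    then have "q mod 4 = 1" using \<open>odd q\<close> by presburger
    then have "N mod 4 = M mod 4" unfolding M by (metis mod_mult_left_eq mult_1)
    then show ?thesis using \<open>M mod 4 \<noteq> 3\<close> by simp
  qed
qed

lemma lucas_u_add_cong:
  assumes "even k"
  shows "[lucas_u t (a + 2 * k * j) = (-1) ^ j * lucas_u t a] (mod lucas_v t k)"
proof (induction j)
  case (Suc j)
  have "lucas_u t (a + 2 * k * Suc j) = 
    lucas_u t (a + 2 * k * j + k) * lucas_v t k - lucas_u t (a + 2 * k * j)"
    using lucas_u_add_double[of t "a + 2 * k * j" k] assms by (simp add: algebra_simps)
  then have "[lucas_u t (a + 2 * k * Suc j) = - lucas_u t (a + 2 * k * j)] (mod lucas_v t k)"
    by (simp add: cong_iff_dvd_diff)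
  also have "[- lucas_u t (a + 2 * k * j) = - ((-1) ^ j * lucas_u t a)] (mod lucas_v t k)"
    using Suc by (simp add: cong_minus_minus_iff)
  finally show ?case by simp
qed simp

text \<open>Cohn's argument: write \<open>r = \<plusminus>1 + 2 * k * 3 ^ s\<close> with \<open>k\<close> even and prime to 3. Then
  \<open>lucas_u t r\<close> is congruent to \<open>-1\<close> modulo \<open>lucas_v t k\<close>, which is 3 modulo 4.\<close>

lemma lucas_u_odd_index_square:
  assumes t: "odd t" "t > 0" and r: "odd r" and sq: "lucas_u t r = a\<^sup>2"
  shows "r = 1"
proof (rule ccontr)
  assume "r \<noteq> 1"
  obtain c where c: "c > 0" "r = 4 * c + 1 \<or> r + 1 = 4 * c"
  proof -
    have "r mod 4 = 1 \<or> r mod 4 = 3" using r by presburger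
    then show ?thesis
    proof
      assume "r mod 4 = 1"
      then have "r = 4 * (r div 4) + 1" using mult_div_mod_eq[of 4 r] by presburger
      then show ?thesis using that[of "r div 4"] \<open>r \<noteq> 1\<close> by force
    next
      assume "r mod 4 = 3"
      then have "r + 1 = 4 * (r div 4 + 1)" by presburger
      then show ?thesis using that[of "r div 4 + 1"] by force
    qed
  qed
  have "c \<noteq> 0" "\<not> is_unit (3::nat)" using c(1) by auto
  then obtain k' where "c = 3 ^ multiplicity 3 c * k'" "\<not> 3 dvd k'"
    by (rule multiplicity_decompose')
  then obtain s where k': "c = 3 ^ s * k'" "\<not> 3 dvd k'" by blast
  \<comment> \<open>The factor 2 makes \<open>k\<close> even, with
    \<open>4 * c = 2 * k * 3 ^ s\<close>; removing the powers of 3 makes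
    \<open>lucas_v_mod_4\<close> applicable to \<open>k\<close>.\<close>
  define k where "k = 2 * k'"
  have k: "even k" "\<not> 3 dvd k" "k > 0"
    using k' c by (auto simp: k_def prime_dvd_mult_iff intro: Nat.gr0I)
  have "[lucas_u t r = -1] (mod lucas_v t k)"
    using c(2)
  proof
    assume "r = 4 * c + 1"
    \<comment> \<open>\<open>3 ^ s\<close> is odd, so the sign changes an odd number of times,
      starting from \<open>lucas_u t 1 = 1\<close>.\<close>
    then show ?thesis using lucas_u_add_cong[OF k(1), of t 1 "3 ^ s"]
      by (simp add: k' k_def mult_ac)
  next
    assume r1: "r + 1 = 4 * c"
    obtain j where j: "k = Suc j" using k by (cases k) auto
    obtain i where i: "(3::nat) ^ s = Suc (2 * i)" 
      by (metis One_nat_def Suc_eq_plus1 even_power odd_numeral oddE)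
    have "r + 1 = 2 * k * Suc (2 * i)" using r1 i by (simp add: k_def k')
    \<comment> \<open>\<open>2 * k * 3 ^ s - 1\<close> is \<open>2 * k - 1\<close> plus an even
      number of shifts by \<open>2 * k\<close>; at \<open>2 * k - 1 = 2 * j + 1\<close> the residue
      is \<open>(-1) ^ j\<close> with \<open>j\<close> odd.\<close>
    then have "r = (2 * j + 1) + 2 * k * (2 * i)" using j by (simp add: algebra_simps)
    then have "[lucas_u t r = lucas_u t (2 * j + 1)] (mod lucas_v t k)"
      using lucas_u_add_cong[OF k(1), of t "2 * j + 1" "2 * i"] by simp
    also have "[lucas_u t (2 * j + 1) = -1] (mod lucas_v t k)"
      using k(1) by (simp only: lucas_u_double_pred j) (simp add: cong_iff_dvd_diff)
    finally show ?thesis .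
  qed
  then have "int (nat (lucas_v t k)) dvd a\<^sup>2 + 1"
    using lucas_v_pos[OF t(2), of k] by (simp add: sq cong_iff_dvd_diff)
  then have "nat (lucas_v t k) mod 4 \<noteq> 3" by (rule no_square_minus_one_mod_4)
  moreover have "lucas_v t k mod 4 = 3" using lucas_v_mod_4 t k by blast
  ultimately show False
    using lucas_v_pos[OF t(2), of k] nat_mod_distrib[of "lucas_v t k" 4] by simp
qed

section \<open>Divisibility of terms and odd multiples of an index\<close>

lemma dvd_lucas_u_cancel:
  assumes "d dvd lucas_u t a" "d dvd lucas_u t (a + b)"
  shows "d dvd lucas_u t b"
proof (cases a)
  case (Suc j)
  \<comment> \<open>The addition formula isolates this product, and consecutive terms are coprime,
    so \<open>d\<close> is coprime to its first factor.\<close>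
  have "d dvd lucas_u t j * lucas_u t b"
    using assms lucas_u_add[of t j b] unfolding Suc
    by (metis add_Suc dvd_add_right_iff dvd_mult2)
  moreover have "coprime d (lucas_u t j)"
    using coprime_lucas_u_Suc[of t j] assms(1) unfolding Suc
    by (meson coprime_commute coprime_divisors dvd_refl)
  ultimately show ?thesis by (simp add: coprime_dvd_mult_right_iff)
qed (use assms in auto)

lemma dvd_lucas_u_mod:
  assumes "d dvd lucas_u t a" "d dvd lucas_u t r"
  shows "d dvd lucas_u t (r mod a)"
proof -
  have "d dvd lucas_u t (q * a + s) \<Longrightarrow> d dvd lucas_u t s" for q s
    by (induction q) (use dvd_lucas_u_cancel[OF assms(1)] in \<open>auto simp: add.assoc\<close>)
  then show ?thesis using assms(2) by (metis div_mult_mod_eq)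
qed

text \<open>Minimality holds only among odd indices. With \<open>s = r mod a\<close>,
  \<open>d\<close> divides the terms at \<open>s\<close> and at \<open>a - s\<close>; as
  \<open>a\<close> is odd, one of the two is odd, and it is smaller than \<open>a\<close> unless
  \<open>s = 0\<close>.\<close>

lemma least_odd_rank_dvd:
  assumes "odd a" "d dvd lucas_u t a"
    and least: "\<And>r. r > 0 \<Longrightarrow> odd r \<Longrightarrow> d dvd lucas_u t r \<Longrightarrow> a \<le> r"
    and "d dvd lucas_u t r"
  shows "a dvd r"
proof -
  define s where "s = r mod a"
  have s: "s < a" "d dvd lucas_u t s"
    using assms by (auto simp: s_def dvd_lucas_u_mod odd_pos)
  have "d dvd lucas_u t (a - s)"
    using dvd_lucas_u_cancel[of d t s "a - s"] s assms by simp
  then have "s = 0"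
    using least[of s] least[of "a - s"] s \<open>odd a\<close> by (cases "odd s"; force)
  then show ?thesis by (auto simp: s_def)
qed

text \<open>By \<open>lucas_u_add_double\<close> with odd \<open>a\<close>, terms at consecutive odd
  multiples of \<open>a\<close> differ by a multiple of \<open>lucas_v t a\<close>.\<close>

lemma lucas_u_odd_multiple_cong:
  assumes "odd a" "odd s"
  shows "[lucas_u t (a * s) = lucas_u t a] (mod lucas_v t a)"
proof -
  have "[lucas_u t (a * (2 * i + 1)) = lucas_u t a] (mod lucas_v t a)" for i
  proof (induction i)
    case (Suc i)
    have "lucas_u t (a * (2 * Suc i + 1)) =
      lucas_u t (a * (2 * i + 2)) * lucas_v t a + lucas_u t (a * (2 * i + 1))"
      using lucas_u_add_double[of t "a * (2 * i + 1)" a] assms by (simp add: algebra_simps)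
    then show ?case using Suc by (simp add: cong_iff_dvd_diff add_diff_eq[symmetric] del: mult_Suc_right)
  qed simp
  then show ?thesis using assms(2) by (metis oddE)
qed

section \<open>Binet's formulas\<close>

lemma lucas_u_binet:
  fixes \<epsilon> \<epsilon>' :: real
  assumes "\<epsilon>\<^sup>2 = of_int t * \<epsilon> + 1" "\<epsilon>'\<^sup>2 = of_int t * \<epsilon>' + 1"
  shows "of_int (lucas_u t j) * (\<epsilon> - \<epsilon>') = \<epsilon> ^ j - \<epsilon>' ^ j"
proof (induction j rule: induct_nat_012)
  case (ge2 j)
  have "\<epsilon> ^ Suc (Suc j) = of_int t * \<epsilon> ^ Suc j + \<epsilon> ^ j"
    "\<epsilon>' ^ Suc (Suc j) = of_int t * \<epsilon>' ^ Suc j + \<epsilon>' ^ j"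
    using arg_cong[OF assms(1), of "\<lambda>x. x * \<epsilon> ^ j"] arg_cong[OF assms(2), of "\<lambda>x. x * \<epsilon>' ^ j"]
    by (simp_all add: power2_eq_square algebra_simps)
  moreover have "of_int (lucas_u t (Suc (Suc j))) * (\<epsilon> - \<epsilon>') =
     of_int t * (of_int (lucas_u t (Suc j)) * (\<epsilon> - \<epsilon>')) + of_int (lucas_u t j) * (\<epsilon> - \<epsilon>')"
    by (simp add: algebra_simps)
  ultimately show ?case by (simp only: ge2) (simp add: algebra_simps)
qed simp_all

lemma lucas_v_binet:
  fixes \<epsilon> \<epsilon>' :: real
  assumes "\<epsilon>\<^sup>2 = of_int t * \<epsilon> + 1" "\<epsilon>'\<^sup>2 = of_int t * \<epsilon>' + 1" "\<epsilon> + \<epsilon>' = of_int t"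
  shows "of_int (lucas_v t j) = \<epsilon> ^ j + \<epsilon>' ^ j"
proof (induction j rule: induct_nat_012)
  case (ge2 j)
  have "\<epsilon> ^ Suc (Suc j) = of_int t * \<epsilon> ^ Suc j + \<epsilon> ^ j"
    "\<epsilon>' ^ Suc (Suc j) = of_int t * \<epsilon>' ^ Suc j + \<epsilon>' ^ j"
    using arg_cong[OF assms(1), of "\<lambda>x. x * \<epsilon> ^ j"] arg_cong[OF assms(2), of "\<lambda>x. x * \<epsilon>' ^ j"]
    by (simp_all add: power2_eq_square algebra_simps)
  moreover have "of_int (lucas_v t (Suc (Suc j))) =
     of_int t * of_int (lucas_v t (Suc j)) + (of_int (lucas_v t j) :: real)"
    by simp
  ultimately show ?case by (simp only: ge2) (simp add: algebra_simps)
qed (use assms(3) in simp_all)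

section \<open>Units and the square class condition\<close>

lemma odd_square_mod_8:
  fixes a :: nat
  assumes "odd a"
  shows "a\<^sup>2 mod 8 = 1"
proof -
  obtain b where b: "a = 2 * b + 1" using assms by (elim oddE)
  have "even (b * (b + 1))" by simp
  then obtain c where "b * (b + 1) = 2 * c" by (elim evenE)
  moreover have "a\<^sup>2 = 4 * (b * (b + 1)) + 1" by (simp add: b power2_eq_square algebra_simps)
  ultimately have "a\<^sup>2 = 8 * c + 1" by simp
  then show ?thesis by simp
qed

text \<open>With \<open>n = 2 * n'\<close> the equation reads
  \<open>y\<^sup>2 * d = 4 * (n'\<^sup>2 + 4)\<close>. An odd \<open>y\<close> would put 4 into
  \<open>d\<close>; after cancelling 4, all odd squares are 1 modulo 8.\<close>

lemma squarefree_part_mod_8: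
  fixes n y d :: nat
  assumes "[n = 2] (mod 4)" "n\<^sup>2 + 16 = y\<^sup>2 * d" "squarefree d"
  shows "even y" "d mod 8 = 5"
proof -
  obtain n' where n': "n = 2 * n'" "odd n'"
  proof
    show "n = 2 * (n div 2)" "odd (n div 2)" using assms(1) by (auto simp: cong_def) presburger+
  qed
  have eq: "y\<^sup>2 * d = 4 * (n'\<^sup>2 + 4)" using assms(2) n' by (simp add: power_mult_distrib)
  show "even y"
  proof (rule ccontr)
    assume "odd y"
    then have "coprime (2\<^sup>2) (y\<^sup>2)" by (simp only: coprime_power_left_iff coprime_power_right_iff) simp
    moreover have "2\<^sup>2 dvd y\<^sup>2 * d" using eq by simp
    ultimately have "2\<^sup>2 dvd d" by (simp only: coprime_dvd_mult_right_iff)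
    then show False using assms(3) squarefreeD[of d 2] by simp
  qed
  then obtain y' where y': "y = 2 * y'" by (elim evenE)
  have eq': "y'\<^sup>2 * d = n'\<^sup>2 + 4" using eq by (simp add: y' power_mult_distrib)
  moreover have n8: "n'\<^sup>2 mod 8 = 1" using odd_square_mod_8 n' by blast
  ultimately have "(y'\<^sup>2 * d) mod 8 = 5" by presburger
  moreover have "odd (y'\<^sup>2 * d)" unfolding eq' using n' by simp
  then have "y'\<^sup>2 mod 8 = 1" using odd_square_mod_8 by simp
  ultimately show "d mod 8 = 5" by (metis mod_mult_left_eq mult_1)
qed

text \<open>A negative \<open>Y\<close> is replaced by its absolute value: as \<open>m + Y * S\<close> has norm \<open>-16\<close>, passing to the
  conjugate changes \<open>(m + Y * S) * Y\<close> only by a square.\<close>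

lemma positive_square_class:
  fixes n y d m :: nat and Y :: int and b :: real
  defines "S \<equiv> sqrt (real d)"
  assumes F: "is_subfield F" "S \<in> F" and "b \<in> F" and "y > 0" "d > 0" and "Y \<noteq> 0"
    and Y: "Y\<^sup>2 * int d = int (m\<^sup>2 + 16)"
    and eq: "(real m + of_int Y * S) * of_int Y = b\<^sup>2 * (real n + real y * S) * real y"
  shows "\<exists>Z>0. \<exists>c\<in>F. Z\<^sup>2 * d = m\<^sup>2 + 16 \<and>
    (real m + real Z * S) * real Z = c\<^sup>2 * (real n + real y * S) * real y"
proof (cases "Y > 0")
  case True
  have "int ((nat Y)\<^sup>2 * d) = int (m\<^sup>2 + 16)" using Y True by simp
  then have "(nat Y)\<^sup>2 * d = m\<^sup>2 + 16" by (simp only: of_nat_eq_iff)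
  then show ?thesis
    using True eq \<open>b \<in> F\<close> by (intro exI[of _ "nat Y"] conjI bexI[of _ b]) auto
next
  case False
  define Z where "Z = nat (- Y)"
  have Z: "of_int Y = - real Z" "Z > 0" using False \<open>Y \<noteq> 0\<close> by (auto simp: Z_def)
  have "int (Z\<^sup>2 * d) = int (m\<^sup>2 + 16)" using Y False by (simp add: Z_def)
  then have Zd: "Z\<^sup>2 * d = m\<^sup>2 + 16" by (simp only: of_nat_eq_iff)
  have S: "S\<^sup>2 = real d" "S > 0" using \<open>d > 0\<close> by (auto simp: S_def)
  define A where "A = (real n + real y * S) * real y"
  have A: "A > 0" "A \<in> F"
  proof -
    show "A > 0" unfolding A_def using S \<open>y > 0\<close> by (intro mult_pos_pos add_nonneg_pos) auto
    show "A \<in> F" unfolding A_def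
      using F Rats_subset_subfield[OF F(1)] by (intro is_subfieldD(4,5)[OF F(1)]) auto
  qed
  have eq': "(real m - real Z * S) * - real Z = b\<^sup>2 * A"
    using eq by (simp add: Z A_def algebra_simps)
  have Zd': "(real Z)\<^sup>2 * S\<^sup>2 = (real m)\<^sup>2 + 16"
    using arg_cong[OF Zd, of real] by (simp add: S)
  have "(real m + real Z * S) * (real m - real Z * S) = (real m)\<^sup>2 - (real Z)\<^sup>2 * S\<^sup>2"
    by (simp add: power2_eq_square algebra_simps)
  then have norm: "(real m + real Z * S) * (real m - real Z * S) = -16" using Zd' by simp
  \<comment> \<open>Multiplying \<open>eq'\<close> by the conjugate solves for
    \<open>m + Z * S\<close>; the extra factor \<open>Z\<close> then makes the quotient by
    \<open>A\<close> the square of \<open>4 * Z / (b * A)\<close>.\<close>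
  have "b\<^sup>2 * A * (real m + real Z * S) = real Z * 16"
    using norm unfolding eq'[symmetric] by (simp add: mult_ac)
  moreover then have "b \<noteq> 0" using Z(2) by auto
  ultimately have "(real m + real Z * S) = real Z * 16 / (b\<^sup>2 * A)"
    using A(1) by (simp add: field_simps)
  then have "(real m + real Z * S) * real Z = (4 * real Z / (b * A))\<^sup>2 * A"
    using \<open>b \<noteq> 0\<close> A(1) by (simp add: power_divide power_mult_distrib power2_eq_square mult_ac)
  moreover have "4 * real Z / (b * A) \<in> F"
    using A \<open>b \<in> F\<close> Rats_subset_subfield[OF F(1)] by (intro is_subfieldD(5,7)[OF F(1)]) auto
  ultimately show ?thesis
    using Z(2) Zd by (intro exI[of _ Z] conjI bexI[of _ "4 * real Z / (b * A)"]) (auto simp: A_def mult.assoc)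
qed

lemma algebraic_int_monic_quadratic:
  fixes x :: real
  assumes "x\<^sup>2 = of_int a * x + of_int b"
  shows "algebraic_int x"
proof (rule algebraic_int.intros)
  let ?p = "[:- of_int b, - of_int a, 1 :: real:]"
  show "lead_coeff ?p = 1" by simp
  show "\<forall>i. coeff ?p i \<in> \<int>" by (auto simp: coeff_pCons split: nat.splits)
  show "poly ?p x = 0" using assms by (simp add: power2_eq_square algebra_simps)
qed

lemma powi_gt_1_cases:
  fixes \<epsilon> \<eta> :: real
  assumes "\<epsilon> > 1" "\<eta> > 1" "\<eta> = \<epsilon> powi k \<or> \<eta> = - (\<epsilon> powi k)"
  shows "\<exists>j. \<eta> = \<epsilon> ^ j"
proof -
  have "\<epsilon> powi k > 0" using assms(1) by simp
  then have \<eta>: "\<eta> = \<epsilon> powi k" using assms(2,3) by (smt (verit))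
  show ?thesis
  proof (cases "k \<ge> 0")
    case True
    then show ?thesis using \<eta> by (auto simp: power_int_def)
  next
    case False
    then have "\<eta> = inverse \<epsilon> ^ nat (- k)" using \<eta> by (simp add: power_int_def)
    also have "\<dots> \<le> 1" using assms(1) by (intro power_le_one) (auto simp: field_simps)
    finally show ?thesis using assms(2) by simp
  qed
qed

theorem theorem4:
  fixes n y d r\<^sub>0 p :: nat and \<epsilon> \<epsilon>' :: real and u v :: "nat \<Rightarrow> int"
  assumes "n > 0" and "[n = 2] (mod 4)"
    and "n\<^sup>2 + 16 = y\<^sup>2 * d" and "y > 0" and "squarefree d"
    and "\<epsilon> = (real n + real y * sqrt (real d)) / 4"
    and "\<epsilon>' = (real n - real y * sqrt (real d)) / 4"
    and "fundamental_unit (rat_adjoin (sqrt (real d))) \<epsilon>"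
    and "\<And>j. real_of_int (u j) = (\<epsilon> ^ j - \<epsilon>' ^ j) / (\<epsilon> - \<epsilon>')"
    and "\<And>j. real_of_int (v j) = \<epsilon> ^ j + \<epsilon>' ^ j"
    and "r\<^sub>0 > 0" and "odd r\<^sub>0" and "int d dvd u r\<^sub>0"
    and "\<And>r. r > 0 \<Longrightarrow> odd r \<Longrightarrow> int d dvd u r \<Longrightarrow> r\<^sub>0 \<le> r"
    and "prime p" and "[p = 1] (mod 4)" and "int p dvd v r\<^sub>0"
    and "\<not> QuadRes (int p) (int d * u r\<^sub>0)"
  shows "\<not> (\<exists>m. m > 0 \<and> m \<noteq> 3 \<and> m \<noteq> n \<and>
            (\<exists>K. is_quartic_field m K \<and> is_quartic_field n K))"
proof
  assume "\<exists>m. m > 0 \<and> m \<noteq> 3 \<and> m \<noteq> n \<and> (\<exists>K. is_quartic_field m K \<and> is_quartic_field n K)"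
  then obtain m \<rho> \<sigma> where m: "m > 0" "m \<noteq> 3" "m \<noteq> n"
    and roots: "poly (quartic_poly n) \<rho> = 0" "poly (quartic_poly m) \<sigma> = (0::complex)"
    and "rat_adjoin \<rho> = rat_adjoin \<sigma>"
    by (auto simp: is_quartic_field_def)
  then have mem: "\<sigma> \<in> rat_adjoin \<rho>" using self_in_rat_adjoin by blast

  \<comment> \<open>The square class relation over the real quadratic field\<close>
  note n = assms(3) and y = \<open>y > 0\<close> and d = \<open>squarefree d\<close>
  have "even y" and d8: "d mod 8 = 5"
    using squarefree_part_mod_8[OF assms(2) n d] by auto
  have d1: "d \<noteq> 1" and d0: "d > 0" using d8 by (auto intro: Nat.gr0I)
  define S where "S = sqrt (real d)"
  define F where "F = rat_adjoin S"
  have S2: "S\<^sup>2 = real d" and S0: "S > 0" using d0 by (auto simp: S_def)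
  have SQ: "S \<notin> \<rat>" using Rats_square_neq_squarefree[OF d d1] S2 by blast
  have F: "is_subfield F" "S \<in> F"
    by (auto simp: F_def is_subfield_rat_adjoin self_in_rat_adjoin)
  have FQ: "F = quad_ext \<rat> S" unfolding F_def by (rule rat_adjoin_sqrt) (use S2 SQ in auto)
  note F' = is_subfieldD[OF F(1)] and QF = Rats_subset_subfield[OF F(1)]

  obtain Y :: int and e f :: rat where Y: "Y \<noteq> 0" "Y\<^sup>2 * int d = int (m\<^sup>2 + 16)"
    and ef: "of_nat m * of_int Y = (e\<^sup>2 + f\<^sup>2 * of_nat d) * of_nat n * of_nat y +
        2 * e * f * (of_nat y)\<^sup>2 * of_nat d"
      "(of_int Y)\<^sup>2 = (e\<^sup>2 + f\<^sup>2 * of_nat d) * (of_nat y)\<^sup>2 + 2 * e * f * of_nat n * of_nat y"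
    using quartic_root_in_quartic_field[OF roots mem n y d d1 m(1,2)] by blast
  \<comment> \<open>The coefficients \<open>e\<close>, \<open>f\<close> are rational, so the
    relation found over a complex square root of \<open>d\<close> carries over to the positive real
    root \<open>S\<close>.\<close>
  define b where "b = of_rat e + of_rat f * S"
  have "b \<in> F" by (auto simp: FQ b_def intro: quad_extI)
  have efR: "real m * of_int Y = ((of_rat e)\<^sup>2 + (of_rat f)\<^sup>2 * S\<^sup>2) * real n * real y +
        2 * of_rat e * of_rat f * (real y)\<^sup>2 * S\<^sup>2"
      "(of_int Y :: real)\<^sup>2 = ((of_rat e)\<^sup>2 + (of_rat f)\<^sup>2 * S\<^sup>2) * (real y)\<^sup>2 +
        2 * of_rat e * of_rat f * real n * real y"
    using ef[THEN arg_cong[of _ _ "of_rat :: rat \<Rightarrow> real"]]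
    by (simp_all add: S2 of_rat_mult of_rat_add of_rat_power)
  have "(real m + of_int Y * S) * of_int Y = real m * of_int Y + (of_int Y)\<^sup>2 * S"
    by (simp add: power2_eq_square algebra_simps)
  also have "\<dots> = b\<^sup>2 * (real n + real y * S) * real y"
    unfolding efR by (simp add: b_def power2_eq_square algebra_simps)
  finally obtain Z c where Z: "Z > 0" "Z\<^sup>2 * d = m\<^sup>2 + 16" and c: "c \<in> F"
    and Zc: "(real m + real Z * S) * real Z = c\<^sup>2 * (real n + real y * S) * real y"
    using positive_square_class[OF F[unfolded S_def] \<open>b \<in> F\<close> y d0 Y] unfolding S_def by blast

  \<comment> \<open>Evenness gives \<open>\<eta>\<close> below an integral trace. An odd
    \<open>m\<close> would make \<open>Z\<^sup>2 * d\<close> congruent to 5 but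
    \<open>m\<^sup>2 + 16\<close> congruent to 1 modulo 8.\<close>
  have "even m"
  proof (rule ccontr)
    assume "odd m"
    then have "odd (Z\<^sup>2 * d)" unfolding Z(2) by simp
    then have "Z\<^sup>2 mod 8 = 1" using odd_square_mod_8 by simp
    then have "(Z\<^sup>2 * d) mod 8 = 5" using d8 by (metis mod_mult_left_eq mult_1)
    then show False using odd_square_mod_8[OF \<open>odd m\<close>] unfolding Z(2) by presburger
  qed
  then obtain m' where m': "m = 2 * m'" by (elim evenE)

  \<comment> \<open>\<open>\<eta>\<close> as a power of the fundamental unit\<close>
  define \<eta> where "\<eta> = (real m + real Z * S) / 4"
  define \<eta>' where "\<eta>' = (real m - real Z * S) / 4"
  have ZS: "(real Z * S)\<^sup>2 = (real m)\<^sup>2 + 16"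
    using arg_cong[OF Z(2), of real] by (simp add: power_mult_distrib S2)
  have norm: "\<eta> * \<eta>' = -1"
  proof -
    have "\<eta> * \<eta>' = ((real m)\<^sup>2 - (real Z * S)\<^sup>2) / 16"
      by (simp add: \<eta>_def \<eta>'_def power2_eq_square algebra_simps)
    then show ?thesis by (simp add: ZS)
  qed
  have trace: "\<eta> + \<eta>' = real m'" by (simp add: \<eta>_def \<eta>'_def m' field_simps)
  have \<eta>F: "\<eta> \<in> F" "\<eta>' \<in> F"
    unfolding \<eta>_def \<eta>'_def using F(2) QF by (intro F'(4-7); auto)+
  have quad: "x\<^sup>2 = of_int (int m') * x + of_int 1" if "x = \<eta> \<or> x = \<eta>'" for x
  proof -
    have "x\<^sup>2 = (\<eta> + \<eta>') * x - \<eta> * \<eta>'"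
      using that by (auto simp: power2_eq_square algebra_simps)
    then show ?thesis by (simp add: norm trace)
  qed
  have "algebraic_int \<eta>" "algebraic_int \<eta>'"
    using algebraic_int_monic_quadratic[OF quad] by auto
  then have "\<eta> \<in> integer_units F"
    unfolding integer_units_def ring_of_integers_def using \<eta>F norm
    by (auto intro!: bexI[of _ "- \<eta>'"] F'(2) algebraic_int_minus)
  then obtain k where k: "\<eta> = \<epsilon> powi k \<or> \<eta> = - (\<epsilon> powi k)"
    using assms(8) unfolding fundamental_unit_def F_def S_def by blast
  have "\<epsilon> > 1" using assms(8) by (simp add: fundamental_unit_def)
  have "\<eta> > 1"
  proof -
    have "real Z * S \<ge> 4"
      by (rule power2_le_imp_le) (use ZS Z(1) S0 in auto)
    then show ?thesis using m(1) by (simp add: \<eta>_def)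
  qed
  then obtain j where j: "\<eta> = \<epsilon> ^ j" using powi_gt_1_cases[OF \<open>\<epsilon> > 1\<close> _ k] by blast

  \<comment> \<open>The given sequences as Lucas sequences\<close>
  have \<epsilon>: "\<epsilon> = (real n + real y * S) / 4" "\<epsilon>' = (real n - real y * S) / 4"
    using assms(6,7) by (auto simp: S_def)
  have \<epsilon>F: "\<epsilon> \<in> F" unfolding \<epsilon> using F(2) QF by (intro F'(4-7); auto)
  have yS: "(real y * S)\<^sup>2 = (real n)\<^sup>2 + 16"
    using arg_cong[OF n, of real] by (simp add: power_mult_distrib S2)
  have \<epsilon>norm: "\<epsilon> * \<epsilon>' = -1"
  proof -
    have "\<epsilon> * \<epsilon>' = ((real n)\<^sup>2 - (real y * S)\<^sup>2) / 16"
      by (simp add: \<epsilon> power2_eq_square algebra_simps)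
    then show ?thesis by (simp add: yS)
  qed
  obtain n' where n': "n = 2 * n'" "odd n'"
  proof
    show "n = 2 * (n div 2)" "odd (n div 2)" using assms(2) unfolding cong_def by presburger+
  qed
  define t where "t = int n'"
  have t: "odd t" "t > 0" "real_of_int t = real n / 2"
    using n' by (auto simp: t_def odd_pos)
  have \<epsilon>trace: "\<epsilon> + \<epsilon>' = of_int t" by (simp add: \<epsilon> t field_simps)
  have \<epsilon>diff: "\<epsilon> - \<epsilon>' = real y * S / 2" by (simp add: \<epsilon> field_simps)
  then have \<epsilon>ne: "\<epsilon> \<noteq> \<epsilon>'" using y S0 by auto
  have \<epsilon>quad: "x\<^sup>2 = of_int t * x + 1" if "x = \<epsilon> \<or> x = \<epsilon>'" for x
  proof -
    have "x\<^sup>2 = (\<epsilon> + \<epsilon>') * x - \<epsilon> * \<epsilon>'"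
      using that by (auto simp: power2_eq_square algebra_simps)
    then show ?thesis by (simp add: \<epsilon>norm \<epsilon>trace)
  qed
  have u: "u i = lucas_u t i" for i
  proof -
    have "real_of_int (u i) * (\<epsilon> - \<epsilon>') = real_of_int (lucas_u t i) * (\<epsilon> - \<epsilon>')"
      using lucas_u_binet[OF \<epsilon>quad[of \<epsilon>] \<epsilon>quad[of \<epsilon>']] assms(9) \<epsilon>ne by simp
    then show ?thesis using \<epsilon>ne by simp
  qed
  have v: "v i = lucas_v t i" for i
  proof -
    have "real_of_int (v i) = real_of_int (lucas_v t i)"
      using lucas_v_binet[OF \<epsilon>quad \<epsilon>quad \<epsilon>trace] assms(10) by simp
    then show ?thesis by simp
  qed

  \<comment> \<open>The exponent \<open>j\<close> and the square class of \<open>u j\<close>\<close>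
  have udiff: "\<epsilon> ^ j - \<epsilon>' ^ j = real_of_int (u j) * (real y * S / 2)"
    using lucas_u_binet[OF \<epsilon>quad[of \<epsilon>] \<epsilon>quad[of \<epsilon>'], of j] u \<epsilon>diff by simp
  \<comment> \<open>Write \<open>\<epsilon> ^ j\<close> as half of \<open>v j\<close> plus half of
    \<open>\<epsilon> ^ j - \<epsilon>' ^ j\<close>, which are its parts along 1 and
    \<open>S\<close>.\<close>
  have "real m / 4 + (real Z / 4) * S =
    real_of_int (v j) / 2 + (real_of_int (u j) * real y / 4) * S"
    using udiff assms(10)[of j] j by (simp add: \<eta>_def field_simps)
  then have "real m / 4 = real_of_int (v j) / 2 \<and> real Z / 4 = real_of_int (u j) * real y / 4"
    by (rule quad_ext_coeff_eq[OF is_subfield_Rats SQ, rotated 4]) auto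
  then have mv: "real m = 2 * of_int (v j)" and Zu: "real Z = of_int (u j) * real y" by auto
  have "\<epsilon>' ^ j = \<eta>'"
  proof -
    have "\<epsilon>' ^ j = of_int (v j) - \<eta>" using assms(10)[of j] j by simp
    also have "\<dots> = real m / 2 - \<eta>" using mv by simp
    also have "\<dots> = \<eta>'" by (simp add: \<eta>_def \<eta>'_def field_simps)
    finally show ?thesis .
  qed
  \<comment> \<open>Compare the norms of \<open>\<eta>\<close> and \<open>\<epsilon> ^ j\<close>:
    both units have norm -1.\<close>
  then have "(-1) ^ j = (-1 :: real)"
    using norm \<epsilon>norm j power_mult_distrib[of \<epsilon> \<epsilon>' j] by simp
  then have "odd j" by (cases "odd j") auto
  then obtain i where i: "j = 2 * i + 1" by (elim oddE)

  have "\<epsilon> ^ j * (of_int (u j) * real y) = c\<^sup>2 * \<epsilon> * real y"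
  proof -
    have "(4 * \<eta>) * real Z = c\<^sup>2 * (4 * \<epsilon>) * real y"
      using Zc by (simp add: \<eta>_def \<epsilon>)
    then show ?thesis unfolding j Zu by simp
  qed
  \<comment> \<open>Since \<open>j = 2 * i + 1\<close>, cancelling \<open>\<epsilon> * y\<close>
    leaves an even power of \<open>\<epsilon>\<close>, which is absorbed into
    \<open>c\<close>.\<close>
  then have "(\<epsilon> ^ i)\<^sup>2 * of_int (u j) = c\<^sup>2"
    using y \<open>\<epsilon> > 1\<close> by (simp add: i power_add power_mult power2_eq_square power_mult_distrib)
  then have usq: "(c / \<epsilon> ^ i)\<^sup>2 = of_int (u j)"
    using \<open>\<epsilon> > 1\<close> by (simp add: power_divide field_simps)
  have "c / \<epsilon> ^ i \<in> F" by (intro F'(7,9) c \<epsilon>F)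
  then have "c / \<epsilon> ^ i \<in> \<rat> \<or> (\<exists>q\<in>\<rat>. c / \<epsilon> ^ i = q * S)"
    unfolding FQ using usq S2 SQ by (intro quad_ext_square_in_base[OF is_subfield_Rats]) auto
  then show False
  proof
    assume "c / \<epsilon> ^ i \<in> \<rat>"
    then have "c / \<epsilon> ^ i \<in> \<int>" using Rats_square_in_Ints usq by (metis Ints_of_int)
    then obtain a where "c / \<epsilon> ^ i = of_int a" by (elim Ints_cases)
    then have "of_int (u j) = (of_int (a\<^sup>2) :: real)" using usq by simp
    then have "lucas_u t j = a\<^sup>2" using u by (simp only: of_int_eq_iff)
    then have "j = 1" using lucas_u_odd_index_square t \<open>odd j\<close> by blast
    then have "v j = t" using v by simp
    then have "real m = real n" using mv t by simp
    then show False using m by simp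
  next
    assume "\<exists>q\<in>\<rat>. c / \<epsilon> ^ i = q * S"
    then obtain q where q: "q \<in> \<rat>" "c / \<epsilon> ^ i = q * S" by blast
    then have "q\<^sup>2 * of_nat d = of_int (u j)" using usq S2 by (simp add: power_mult_distrib)
    then obtain a where a: "a\<^sup>2 * int d = u j"
      using Rats_squarefree_times_square_in_Ints[OF d q(1)] by blast
    then have "int d dvd u j" by (metis dvd_triv_right)
    then have "r\<^sub>0 dvd j"
      using least_odd_rank_dvd[of r\<^sub>0 "int d" t j] assms(12,13,14) u by simp
    then obtain s where s: "j = r\<^sub>0 * s" by blast
    \<comment> \<open>\<open>s\<close> is odd because \<open>j\<close> is, as the congruence
      requires.\<close>
    then have "[u j = u r\<^sub>0] (mod v r\<^sub>0)"
      unfolding u v using \<open>odd j\<close> by (simp add: s lucas_u_odd_multiple_cong)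
    then have "[int d * u j = int d * u r\<^sub>0] (mod int p)"
      by (rule cong_scalar_left[OF cong_dvd_modulus[OF _ assms(17)]])
    \<comment> \<open>Another factor \<open>d\<close> turns \<open>u j = a\<^sup>2 * d\<close> into
      a perfect square, which makes \<open>d * u r\<^sub>0\<close> a quadratic residue modulo
      \<open>p\<close>.\<close>
    moreover have "int d * u j = (int d * a)\<^sup>2" by (simp add: a[symmetric] power2_eq_square)
    ultimately have "QuadRes (int p) (int d * u r\<^sub>0)" by (auto simp: QuadRes_def)
    then show False using assms(18) by blast
  qed
qed

end
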